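(* Let $c\geq 2$ be an integer and let $\mathcal{C}=\{1,2c\}$. Then for every positive integer $n$, $\mathcal{G}_{\mathcal{C}}(n)=s_c(n)$. In other words, the nim-sequence of \textsc{cut} with cut-set $\{1,2c\}$ is \[(0, 1)^c(2, 3)^c, 1, 4, (5, 4)^{c-1}, (3, 2)^c(4, 5)^c(6, 7)^c (+8),\] which is arithmetic-periodic with period $12c$ and saltus $8$.
   Context: For a set $\mathcal{C}$ of positive integers (the cut-set), the nim-sequence $\mathcal{G}_{\mathcal{C}}$ of the game \textsc{cut} is defined recursively on positive integers by \[\mathcal{G}_{\mathcal{C}}(n)=\operatorname{mex}\{\mathcal{G}_{\mathcal{C}}(h_0)\oplus\cdots\oplus\mathcal{G}_{\mathcal{C}}(h_d)\ :\ d\in\mathcal{C},\ h_0,\dots,h_d\geq 1 \text{ integers},\ h_0+\cdots+h_d=n\},\] where $\oplus$ is bitwise XOR (nim-sum) of nonnegative integers and $\operatorname{mex}S$ is the least nonnegative integer not in $S$ (so $\mathcal{G}_{\mathcal{C}}(1)=0$). For $c\geq 2$, define $s_c$ on positive integers as follows: write $n=12cq+m$ with $q\geq 0$ and $1\leq m\leq 12c$, and set $s_c(n)=8q+t(m)$, where $t(m)=0$ (resp. $1$) if $1\le m\le 2c$ and $m$ is odd (resp. even); $t(m)=2$ (resp. $3$) if $2c<m\le 4c$ and $m$ odd (resp. even); $t(4c+1)=1$; $t(m)=5$ (resp. $4$) if $4c+2\le m\le 6c$ and $m$ odd (resp. even); $t(m)=3$ (resp. $2$) if $6c<m\le 8c$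 and $m$ odd (resp. even); $t(m)=4$ (resp. $5$) if $8c<m\le 10c$ and $m$ odd (resp. even); $t(m)=6$ (resp. $7$) if $10c<m\le 12c$ and $m$ odd (resp. even). The notation $(a_1,\dots,a_k)^j$ means the block repeated $j$ times, and $(+8)$ means the listed first $12c$ values are repeated with $8$ added each period. *)

theory Defs
  imports Main
begin

definition mex :: "nat set \<Rightarrow> nat" where
  "mex S = (LEAST k. k \<notin> S)"

definition nim_sum :: "nat list \<Rightarrow> nat" where
  "nim_sum xs = foldr xor xs 0"

text \<open>
  An option of a heap of size \<open>n\<close> is the list \<open>[h\<^sub>0, \<dots>, h\<^sub>d]\<close> of the heaps into which
  it is split by using a number \<open>d\<close> of the cut-set. Cut-sets consist of positive
  integers; the guard \<open>1 \<le> d\<close> discards a possible \<open>0\<close>, which would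
  make the recursion for the nim-sequence ill-founded.
\<close>

definition cut_opts :: "nat set \<Rightarrow> nat \<Rightarrow> nat list set" where
  "cut_opts C n =
     {hs. (\<exists>d\<in>C. 1 \<le> d \<and> length hs = d + 1) \<and> (\<forall>h\<in>set hs. 1 \<le> h) \<and> sum_list hs = n}"

lemma cut_opts_less:
  assumes "hs \<in> cut_opts C n" "h \<in> set hs"
  shows "h < n"
proof -
  from split_list[OF assms(2)] obtain xs ys where hs: "hs = xs @ h # ys"
    by blast
  have "length xs + length ys \<ge> 1"
    using assms(1) by (auto simp: cut_opts_def hs)
  then obtain z where "z \<in> set (xs @ ys)"
    by (cases xs; cases ys) auto
  moreover from this have "z \<ge> 1"
    using assms(1) by (auto simp: cut_opts_def hs)
  ultimately have "sum_list (xs @ ys) \<ge> 1"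
    using member_le_sum_list[of z "xs @ ys"] by simp
  moreover have "n = sum_list (xs @ ys) + h"
    using assms(1) by (simp add: cut_opts_def hs)
  ultimately show ?thesis
    by linarith
qed

text \<open>
  The nim-sequence is indexed by the positive integers; the value at \<open>0\<close> is irrelevant.
\<close>

function nim_seq :: "nat set \<Rightarrow> nat \<Rightarrow> nat" where
  "nim_seq C n = mex ((\<lambda>hs. nim_sum (map (nim_seq C) hs)) ` cut_opts C n)"
  by auto
termination
  by (relation "measure snd") (auto dest: cut_opts_less)

declare nim_seq.simps [simp del]

definition t_val :: "nat \<Rightarrow> nat \<Rightarrow> nat" where
  "t_val c m =
     (if m \<le> 2 * c then (if odd m then 0 else 1)
      else if m \<le> 4 * c then (if odd m then 2 else 3)
      else if m = 4 * c + 1 then 1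
      else if m \<le> 6 * c then (if odd m then 5 else 4)
      else if m \<le> 8 * c then (if odd m then 3 else 2)
      else if m \<le> 10 * c then (if odd m then 4 else 5)
      else (if odd m then 6 else 7))"

text \<open>
  With \<open>n = 12cq + m\<close> and \<open>1 \<le> m \<le> 12c\<close> one has \<open>q = (n - 1) div 12c\<close> and
  \<open>m = (n - 1) mod 12c + 1\<close>; see \<open>s_seq_decomp\<close> below.
\<close>

definition s_seq :: "nat \<Rightarrow> nat \<Rightarrow> nat" where
  "s_seq c n = 8 * ((n - 1) div (12 * c)) + t_val c ((n - 1) mod (12 * c) + 1)"

lemma s_seq_decomp:
  assumes "1 \<le> m" "m \<le> 12 * c"
  shows "s_seq c (12 * c * q + m) = 8 * q + t_val c m"
proof -
  have eq: "12 * c * q + m - 1 = (m - 1) + q * (12 * c)" and less: "m - 1 < 12 * c"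
    using assms by (simp_all add: mult.commute)
  have "(12 * c * q + m - 1) div (12 * c) = q" "(12 * c * q + m - 1) mod (12 * c) = m - 1"
    unfolding eq using less by simp_all
  then show ?thesis
    using assms(1) by (simp add: s_seq_def)
qed

definition rep :: "'a list \<Rightarrow> nat \<Rightarrow> 'a list" where
  "rep xs j = concat (replicate j xs)"

definition cut_block :: "nat \<Rightarrow> nat list" where
  "cut_block c =
     rep [0, 1] c @ rep [2, 3] c @ [1, 4] @ rep [5, 4] (c - 1) @
     rep [3, 2] c @ rep [4, 5] c @ rep [6, 7] c"

text \<open>
  The sequence \<open>(b\<^sub>1, \<dots>, b\<^sub>p) (+s)\<close>, indexed from \<open>1\<close>: the block is repeated, with
  \<open>s\<close> added in each further period.
\<close>

definition plus_seq :: "nat list \<Rightarrow> nat \<Rightarrow> nat \<Rightarrow> nat" where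
  "plus_seq bs s n = bs ! ((n - 1) mod length bs) + s * ((n - 1) div length bs)"

definition arith_periodic :: "(nat \<Rightarrow> nat) \<Rightarrow> nat \<Rightarrow> nat \<Rightarrow> bool" where
  "arith_periodic f p s \<longleftrightarrow> 0 < p \<and> (\<forall>n\<ge>1. f (n + p) = f n + s)"

end

theory Submission
  imports Defs
begin

text \<open>
  Write a heap as \<open>x + 1\<close> and split its value into the parity of \<open>x\<close> and a remaining part
  \<open>w(x)\<close>, so that the value is \<open>w(x) XOR (x mod 2)\<close>. Since the parities of the parts of a
  split add up, they cancel, up to one \<open>XOR 1\<close> for splits into two heaps. The function \<open>w\<close> is constant on
  blocks of length \<open>2c\<close>, apart from one value at \<open>4c\<close>.

  There is a function \<open>wt\<close>, subadditive with respect to \<open>XOR\<close>, such that \<open>wt (w(x))\<close> is the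
  number \<open>x div 2c\<close> of the block of \<open>x\<close>. A split into \<open>2c + 1\<close> heaps lowers the sum of the
  \<open>x\<close> by \<open>2c\<close>, hence the total block number by at least one, and cannot reproduce \<open>w(x)\<close>.
  For splits into two heaps a comparison of blocks suffices. Conversely, splits into
  \<open>2c + 1\<close> heaps realise \<open>w(a) XOR w(b)\<close> whenever \<open>a + b + 2c \<le> x\<close>, because the surplus can be
  put into two equal heaps and one heap of value at most 1. The few missing values come from
  two heaps.
\<close>

unbundle bit_operations_syntax

section \<open>Arithmetic of XOR and mex\<close>

lemma xor_div_8: "(a XOR b) div 8 = (a div 8) XOR (b div 8)" for a b :: nat
  using drop_bit_xor[of 3 a b] by (simp add: drop_bit_eq_div)

lemma xor_mod_8: "(a XOR b) mod 8 = (a mod 8) XOR (b mod 8)" for a b :: nat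
  using take_bit_xor[of 3 a b] by (simp add: take_bit_eq_mod)

text \<open>Multiplication by 8 shifts by three bits and XOR works bit by bit, so the period index
  and the value inside a period never interact.\<close>

lemma xor_8:
  fixes a b u v :: nat
  assumes "u < 8" "v < 8"
  shows "(8 * a + u) XOR (8 * b + v) = 8 * (a XOR b) + (u XOR v)"
proof -
  have "u XOR v < 8"
    using xor_mod_8[of u v] assms by (metis mod_less mod_less_divisor zero_less_numeral)
  then have "((8 * a + u) XOR (8 * b + v)) div 8 = (8 * (a XOR b) + (u XOR v)) div 8"
      "((8 * a + u) XOR (8 * b + v)) mod 8 = (8 * (a XOR b) + (u XOR v)) mod 8"
    using assms unfolding xor_div_8 xor_mod_8 by simp_all
  then show ?thesis
    by (metis div_mult_mod_eq)
qed

lemma xor_le_add: "a XOR b \<le> a + b" for a b :: nat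
proof (induction a arbitrary: b rule: less_induct)
  case (less a)
  show ?case
  proof (cases "a = 0")
    case False
    then have "(a div 2) XOR (b div 2) \<le> a div 2 + b div 2"
      by (intro less.IH) simp
    moreover have "a XOR b = of_bool (odd a \<noteq> odd b) + 2 * ((a div 2) XOR (b div 2))"
      by (rule xor_rec)
    ultimately show ?thesis
      by (cases "odd a"; cases "odd b") (auto elim!: evenE oddE)
  qed simp
qed

lemma xor_mod_2: "(a mod 2) XOR (b mod 2) = (a + b) mod 2" for a b :: nat
  by (cases "even a"; cases "even b") (auto simp: mod2_eq_if)

lemma mex_eqI: "v \<notin> S \<Longrightarrow> (\<And>g. g < v \<Longrightarrow> g \<in> S) \<Longrightarrow> mex S = v"
  unfolding mex_def by (rule Least_equality) (auto simp flip: not_less)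

lemma less_8_cases:
  fixes v :: nat
  assumes "v < 8"
  obtains "v = 0" | "v = 1" | "v = 2" | "v = 3" | "v = 4" | "v = 5" | "v = 6" | "v = 7"
  using assms by linarith

section \<open>A subadditive weight bounding nim-sums\<close>

text \<open>
  \<open>wt_low\<close> is the largest subadditive function on \<open>{0..7}\<close> with weight at most 1 at \<open>2\<close> and
  at most 2 at \<open>1\<close> and \<open>5\<close>, the values of \<open>w\<close> on the blocks 1 and 2.
\<close>

definition wt_low :: "nat \<Rightarrow> nat" where
  "wt_low v = [0, 2, 1, 3, 4, 2, 5, 3] ! v"

text \<open>A saltus of 8 corresponds to a period of six blocks of length \<open>2 * c\<close>,
  hence the factor 6.\<close>

definition wt :: "nat \<Rightarrow> nat" where
  "wt n = 6 * (n div 8) + wt_low (n mod 8)"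

lemma wt_low_xor:
  assumes "a < 8" "b < 8"
  shows "wt_low (a XOR b) \<le> wt_low a + wt_low b"
  using assms by (elim less_8_cases) (simp_all add: wt_low_def)

text \<open>The low three bits are a finite check; above them XOR is bounded by addition.\<close>

lemma wt_xor: "wt (a XOR b) \<le> wt a + wt b"
  using wt_low_xor[of "a mod 8" "b mod 8"] xor_le_add[of "a div 8" "b div 8"]
  by (simp add: wt_def xor_div_8 xor_mod_8)

section \<open>The sequence with its parity removed\<close>

definition u_val :: "nat \<Rightarrow> nat \<Rightarrow> nat" where
  "u_val c y =
     (if y < 2 * c then 0 else if y < 4 * c then 2 else if y = 4 * c then 1
      else if y < 6 * c then 5 else if y < 8 * c then 3 else if y < 10 * c then 4 else 6)"

definition w_seq :: "nat \<Rightarrow> nat \<Rightarrow> nat" where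
  "w_seq c x = 8 * (x div (12 * c)) + u_val c (x mod (12 * c))"

lemma u_val_less: "u_val c y < 8"
  by (simp add: u_val_def)

lemma w_seq_add: "y < 12 * c \<Longrightarrow> w_seq c (12 * c * q + y) = 8 * q + u_val c y"
  by (simp add: w_seq_def)

lemma w_seq_small: "y < 12 * c \<Longrightarrow> w_seq c y = u_val c y"
  by (simp add: w_seq_def)

lemma s_seq_Suc:
  assumes "c \<ge> 1"
  shows "s_seq c (Suc x) = w_seq c x XOR (x mod 2)"
proof -
  define q y where "q = x div (12 * c)" and "y = x mod (12 * c)"
  have y: "y < 12 * c" and x: "x = 12 * c * q + y"
    using assms by (simp_all add: q_def y_def)
  have "s_seq c (Suc x) = 8 * q + t_val c (Suc y)"
    using s_seq_decomp[of "Suc y" c q] y x by simp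
  moreover have "t_val c (Suc y) = u_val c y XOR (y mod 2)"
    using assms y by (auto simp: t_val_def u_val_def mod2_eq_if)
  moreover have "(8 * q + u_val c y) XOR (y mod 2) = 8 * q + (u_val c y XOR (y mod 2))"
    using xor_8[of "u_val c y" "y mod 2" q 0] u_val_less[of c y] by simp
  ultimately show ?thesis
    using w_seq_add[OF y, of q] x by (simp add: mod2_eq_if)
qed

text \<open>The six blocks carry 0, 2, 5, 3, 4, 6, whose weights are 0 to 5 in this order. The
  exceptional value 1 at \<open>4 * c\<close> weighs as much as 5, so it does not disturb the
  count.\<close>

lemma wt_w_seq:
  assumes "c \<ge> 1"
  shows "wt (w_seq c x) = x div (2 * c)"
proof -
  define q y where "q = x div (12 * c)" and "y = x mod (12 * c)"
  have y: "y < 12 * c" and x: "x = 12 * c * q + y"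
    using assms by (simp_all add: q_def y_def)
  have "x div (2 * c) = 6 * q + y div (2 * c)"
  proof -
    have "x = y + (6 * q) * (2 * c)" using x by simp
    then show ?thesis
      using assms by (metis add.commute div_mult_self1 mult_is_0 not_one_le_zero numeral_eq_iff zero_neq_numeral)
  qed
  moreover have "wt_low (u_val c y) = y div (2 * c)"
  proof -
    have "y div (2 * c) = k" if "2 * c * k \<le> y" "y < 2 * c * Suc k" for k
      using that by (intro div_nat_eqI) (simp_all add: mult.commute)
    from this[of 0] this[of 1] this[of 2] this[of 3] this[of 4] this[of 5] show ?thesis
      using y by (auto simp: wt_low_def u_val_def)
  qed
  ultimately show ?thesis
    using w_seq_add[OF y, of q] x u_val_less[of c y] by (simp add: wt_def)
qed

section \<open>The value of a heap is attained by none of its options\<close>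

definition w_sum :: "nat \<Rightarrow> nat list \<Rightarrow> nat" where
  "w_sum c xs = nim_sum (map (w_seq c) xs)"

lemma nim_sum_s_seq:
  assumes "c \<ge> 1"
  shows "nim_sum (map (s_seq c) (map Suc xs)) = w_sum c xs XOR (sum_list xs mod 2)"
proof (induction xs)
  case Nil
  then show ?case by (simp add: nim_sum_def w_sum_def)
next
  case (Cons x xs)
  then show ?case
    using assms by (simp add: nim_sum_def w_sum_def s_seq_Suc ac_simps flip: xor_mod_2)
qed

lemma wt_w_sum:
  assumes "c \<ge> 1"
  shows "2 * c * wt (w_sum c xs) \<le> sum_list xs"
proof (induction xs)
  case Nil
  then show ?case by (simp add: nim_sum_def w_sum_def wt_def wt_low_def)
next
  case (Cons x xs)
  have "wt (w_sum c (x # xs)) \<le> x div (2 * c) + wt (w_sum c xs)"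
    using wt_xor[of "w_seq c x" "w_sum c xs"] assms
    by (simp add: nim_sum_def w_sum_def wt_w_seq)
  then have "2 * c * wt (w_sum c (x # xs)) \<le> 2 * c * (x div (2 * c)) + 2 * c * wt (w_sum c xs)"
    by (metis mult_le_mono2 distrib_left)
  also have "\<dots> \<le> x + sum_list xs"
    using Cons.IH by (intro add_mono) simp_all
  finally show ?case by simp
qed

lemma w_sum_long_neq:
  assumes "c \<ge> 1"
  shows "w_sum c xs \<noteq> w_seq c (2 * c + sum_list xs)"
proof
  assume "w_sum c xs = w_seq c (2 * c + sum_list xs)"
  then have "wt (w_sum c xs) = Suc (sum_list xs div (2 * c))"
    using assms by (simp add: wt_w_seq div_add_self1)
  then have "2 * c * Suc (sum_list xs div (2 * c)) \<le> sum_list xs"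
    using wt_w_sum[OF assms, of xs] by metis
  then show False
    using assms by (metis Suc_n_not_le_n div_le_mono div_mult_self1_is_m mult_pos_pos zero_less_numeral less_le_trans zero_less_one)
qed

text \<open>Equality would force the period indices to satisfy r = p XOR q \<le> p + q \<le> r, so
  the remainders add without overflow and one period remains to be checked. There the tightest case
  is the value 1 at \<open>4 * c\<close>: two remainders in block 0 give at most
  \<open>4 * c - 1\<close>, two in block 1 at least \<open>4 * c + 1\<close>.\<close>

lemma w_seq_pair_neq:
  assumes "c \<ge> 1"
  shows "w_seq c a XOR w_seq c b XOR 1 \<noteq> w_seq c (Suc (a + b))"
proof
  assume eq: "w_seq c a XOR w_seq c b XOR 1 = w_seq c (Suc (a + b))"
  define p x where "p = a div (12 * c)" and "x = a mod (12 * c)"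
  define q y where "q = b div (12 * c)" and "y = b mod (12 * c)"
  define r z where "r = Suc (a + b) div (12 * c)" and "z = Suc (a + b) mod (12 * c)"
  have x: "x < 12 * c" and a: "a = 12 * c * p + x"
    using assms by (simp_all add: p_def x_def)
  have y: "y < 12 * c" and b: "b = 12 * c * q + y"
    using assms by (simp_all add: q_def y_def)
  have z: "z < 12 * c" and ab: "Suc (a + b) = 12 * c * r + z"
    using assms by (simp_all add: r_def z_def)
  have "r = p XOR q"
    using arg_cong[OF eq, of "\<lambda>n. n div 8"] u_val_less
    by (simp add: xor_div_8 w_seq_def p_def q_def r_def)
  then have "r \<le> p + q"
    using xor_le_add by simp
  moreover have "12 * c * (p + q) < 12 * c * Suc r"
    using a b ab z by (simp add: algebra_simps)
  then have "p + q \<le> r"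
    by (metis mult_less_cancel1 less_Suc_eq_le)
  ultimately have "12 * c * r = 12 * c * p + 12 * c * q"
    by (simp add: algebra_simps)
  then have z_eq: "z = Suc (x + y)"
    using a b ab by linarith
  have "u_val c x XOR u_val c y XOR 1 = u_val c z"
    using arg_cong[OF eq, of "\<lambda>n. n mod 8"] u_val_less
    by (simp add: xor_mod_8 w_seq_def x_def y_def z_def)
  then show False
    using z unfolding z_eq u_val_def by (auto split: if_splits)
qed

section \<open>Values realised by long splits\<close>

lemma w_seq_zero [simp]: "c \<noteq> 0 \<Longrightarrow> w_seq c 0 = 0"
  by (simp add: w_seq_def u_val_def)

lemma w_sum_simps [simp]:
  "w_sum c [] = 0"
  "w_sum c (x # xs) = w_seq c x XOR w_sum c xs"
  by (simp_all add: w_sum_def nim_sum_def)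

lemma w_sum_append: "w_sum c (xs @ ys) = w_sum c xs XOR w_sum c ys"
  by (induction xs) (simp_all add: ac_simps)

lemma w_sum_replicate_zero: "c \<noteq> 0 \<Longrightarrow> w_sum c (replicate k 0) = 0"
  by (induction k) simp_all

lemma long_option_exists:
  assumes "c \<ge> 2" "a + b + 2 * c \<le> x"
  shows "\<exists>xs. length xs = 2 * c + 1 \<and> sum_list xs + 2 * c = x \<and> w_sum c xs = w_seq c a XOR w_seq c b"
proof -
  define k where "k = x - 2 * c - a - b"
  \<comment> \<open>The five explicit entries fit into \<open>2 * c + 1\<close> places because
    \<open>c\<close> is at least 2. The entry \<open>k mod 2\<close> lies in block 0, so it
    contributes 0.\<close>
  define xs where "xs = [a, b, k mod 2, k div 2, k div 2] @ replicate (2 * c - 4) 0"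
  have "w_seq c (k mod 2) = 0"
    using assms(1) by (cases "even k") (simp_all add: mod2_eq_if w_seq_def u_val_def)
  then have "w_sum c xs = w_seq c a XOR w_seq c b"
    using assms(1) by (simp add: xs_def w_sum_append w_sum_replicate_zero del: append.simps)
  moreover have "length xs = 2 * c + 1"
    using assms(1) by (simp add: xs_def)
  moreover have "sum_list xs + 2 * c = x"
  proof -
    have "k mod 2 + (k div 2 + k div 2) = k"
      by presburger
    then show ?thesis
      using assms(2) by (simp add: xs_def k_def sum_list_replicate)
  qed
  ultimately show ?thesis by blast
qed

text \<open>
  Apart from \<open>7\<close>, which needs the two summands \<open>4c + 1\<close> and \<open>2c\<close>, \<open>pos c v\<close> is the first
  argument at which \<open>u_val c\<close> takes the value \<open>v\<close>.
\<close>

definition pos :: "nat \<Rightarrow> nat \<Rightarrow> nat" where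
  "pos c v = [0, 4 * c, 2 * c, 6 * c, 8 * c, 4 * c + 1, 10 * c, 6 * c + 1] ! v"

lemma w_seq_pos:
  assumes "c \<ge> 2" "v < 8"
  shows "\<exists>a b. a + b = 12 * c * j + pos c v \<and> w_seq c a XOR w_seq c b = 8 * j + v"
proof (cases "v = 7")
  case True
  have "w_seq c (12 * c * j + (4 * c + 1)) = 8 * j + 5"
    using assms(1) by (subst w_seq_add) (simp_all add: u_val_def)
  moreover have "w_seq c (2 * c) = 2"
    using assms(1) by (subst w_seq_small) (simp_all add: u_val_def)
  moreover have "(8 * j + 5) XOR 2 = 8 * j + 7"
    using xor_8[of 5 2 j 0] by (simp del: add_2_eq_Suc add_2_eq_Suc')
  ultimately show ?thesis
    using True by (intro exI[of _ "12 * c * j + (4 * c + 1)"] exI[of _ "2 * c"]) (simp add: pos_def)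
next
  case False
  have "pos c v < 12 * c \<and> u_val c (pos c v) = v"
    using assms(2,1) False by (elim less_8_cases) (simp_all add: u_val_def pos_def)
  then have "w_seq c (12 * c * j + pos c v) = 8 * j + v"
    by (simp add: w_seq_add)
  then show ?thesis
    using assms(1) by (intro exI[of _ "12 * c * j + pos c v"] exI[of _ 0]) simp
qed

text \<open>
  The nim-sums of the options of the heap \<open>x + 1\<close>, with the parity of \<open>x\<close> cancelled. The
  extra \<open>XOR 1\<close> arises because the two parts satisfy \<open>a + b = x - 1\<close>.
\<close>

definition opt_vals :: "nat \<Rightarrow> nat \<Rightarrow> nat set" where
  "opt_vals c x =
     {w_sum c xs |xs. length xs = 2 * c + 1 \<and> sum_list xs + 2 * c = x}
     \<union> {w_seq c a XOR w_seq c b XOR 1 |a b. Suc (a + b) = x}"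

lemma w_seq_notin_opt_vals: "c \<ge> 1 \<Longrightarrow> w_seq c x \<notin> opt_vals c x"
  unfolding opt_vals_def
  by (simp del: One_nat_def) (metis add.commute w_sum_long_neq w_seq_pair_neq)

lemma opt_vals_long:
  assumes "c \<ge> 2" "v < 8" "12 * c * j + pos c v + 2 * c \<le> x"
  shows "8 * j + v \<in> opt_vals c x"
proof -
  obtain a b where ab: "a + b = 12 * c * j + pos c v" "w_seq c a XOR w_seq c b = 8 * j + v"
    using w_seq_pos[OF assms(1,2)] by blast
  then obtain xs where "length xs = 2 * c + 1" "sum_list xs + 2 * c = x" "w_sum c xs = 8 * j + v"
    using long_option_exists[OF assms(1), of a b x] assms(3) by metis
  then show ?thesis
    unfolding opt_vals_def by (intro UnI1 CollectI exI[of _ xs]) simp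
qed

text \<open>The first part carries all \<open>q\<close> periods, so the multiple of 8 is left alone
  by the second.\<close>

lemma opt_vals_pair:
  assumes "x < 12 * c" "z < 12 * c"
  shows "8 * q + (u_val c x XOR u_val c z XOR 1) \<in> opt_vals c (12 * c * q + Suc (x + z))"
proof -
  have "w_seq c (12 * c * q + x) XOR w_seq c z XOR 1 = 8 * q + (u_val c x XOR u_val c z XOR 1)"
  proof -
    have "u_val c z XOR 1 < 8"
      using u_val_less[of c z] by (elim less_8_cases) simp_all
    then show ?thesis
      using xor_8[of "u_val c x" "u_val c z XOR 1" q 0] u_val_less[of c x] assms
      by (simp add: w_seq_add w_seq_small)
  qed
  then show ?thesis
    unfolding opt_vals_def by (intro UnI2 CollectI exI[of _ "12 * c * q + x"] exI[of _ z]) simp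
qed

section \<open>Reaching every smaller value\<close>

lemma u_val_eqs:
  "y < 2 * c \<Longrightarrow> u_val c y = 0"
  "2 * c \<le> y \<Longrightarrow> y < 4 * c \<Longrightarrow> u_val c y = 2"
  "4 * c < y \<Longrightarrow> y < 6 * c \<Longrightarrow> u_val c y = 5"
  by (simp_all add: u_val_def)

text \<open>The final \<open>XOR 1\<close> of a two-heap split is left out, so that equal blocks
  give 0.\<close>

definition pair_val :: "nat \<Rightarrow> nat \<Rightarrow> nat \<Rightarrow> bool" where
  "pair_val c y k \<longleftrightarrow> (\<exists>a b. Suc (a + b) = y \<and> u_val c a XOR u_val c b = k)"

text \<open>Two parts in block 0 cover the first range, two parts in block 1 the second. The gap at
  \<open>4 * c\<close> is what produces the exceptional value there.\<close>

lemma pair_val_0: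
  assumes "c \<noteq> 0" "0 < y \<and> y < 4 * c \<or> 4 * c < y \<and> y < 8 * c"
  shows "pair_val c y 0"
proof -
  consider "0 < y" "y \<le> 2 * c" | "2 * c < y" "y < 4 * c" | "4 * c < y" "y \<le> 6 * c" | "6 * c < y" "y < 8 * c"
    using assms(2) by linarith
  then show ?thesis
  proof cases
    case 1
    then show ?thesis
      using assms(1) unfolding pair_val_def by (intro exI[of _ "y - 1"] exI[of _ 0]) (simp add: u_val_eqs)
  next
    case 2
    then show ?thesis
      using assms(1) unfolding pair_val_def by (intro exI[of _ "2 * c - 1"] exI[of _ "y - 2 * c"]) (simp add: u_val_eqs)
  next
    case 3
    then show ?thesis
      using assms(1) unfolding pair_val_def by (intro exI[of _ "2 * c"] exI[of _ "y - 2 * c - 1"]) (simp add: u_val_eqs)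
  next
    case 4
    then show ?thesis
      using assms(1) unfolding pair_val_def by (intro exI[of _ "4 * c - 1"] exI[of _ "y - 4 * c"]) (simp add: u_val_eqs)
  qed
qed

text \<open>One part lies in block 0, the other in block 1.\<close>

lemma pair_val_2:
  assumes "c \<noteq> 0" "2 * c < y" "y < 6 * c"
  shows "pair_val c y 2"
proof (cases "y \<le> 4 * c")
  case True
  then show ?thesis
    using assms unfolding pair_val_def by (intro exI[of _ "y - 1"] exI[of _ 0]) (simp add: u_val_eqs)
next
  case False
  then show ?thesis
    using assms unfolding pair_val_def by (intro exI[of _ "4 * c - 1"] exI[of _ "y - 4 * c"]) (simp add: u_val_eqs)
qed

lemma pair_val_5:
  assumes "c \<noteq> 0" "4 * c + 1 < y" "y \<le> 6 * c"
  shows "pair_val c y 5"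
  using assms unfolding pair_val_def by (intro exI[of _ "y - 1"] exI[of _ 0]) (simp add: u_val_eqs)

text \<open>Two-heap splits are called for only in blocks 0 to 2; from \<open>6 * c\<close> on, and
  at \<open>4 * c\<close> itself, long splits reach everything.\<close>

lemma period_option_exists:
  assumes "c \<noteq> 0" "v < u_val c y XOR (y mod 2)"
  shows "pos c (v XOR (y mod 2)) + 2 * c \<le> y \<or> pair_val c y (v XOR (y mod 2) XOR 1)"
proof -
  have "v < 8"
    using assms(2) u_val_less[of c y] by (elim less_8_cases) (simp_all add: mod2_eq_if split: if_splits)
  note cases_v = less_8_cases[OF this]
  consider "y < 2 * c" | "2 * c \<le> y" "y < 4 * c" | "y = 4 * c" | "4 * c < y" "y < 6 * c"
    | "6 * c \<le> y" "y < 8 * c" | "8 * c \<le> y" "y < 10 * c" | "10 * c \<le> y"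
    by linarith
  then show ?thesis
  proof cases
    case 1
    then have "u_val c y = 0" by (rule u_val_eqs)
    then show ?thesis
      using 1 assms pair_val_0[of c y] by (cases "even y") (simp_all add: mod2_eq_if odd_pos)
  next
    case 2
    have "pair_val c y 0"
      using 2 assms(1) by (intro pair_val_0) auto
    \<comment> \<open>The boundary \<open>y = 2 * c\<close> is even and asks only for
      \<open>v < 2\<close>, which never leads to the pair value 2.\<close>
    moreover have "pair_val c y 2" if "odd y"
    proof -
      have "2 * c < y"
        using 2 that by (cases "y = 2 * c") auto
      then show ?thesis
        using 2 assms(1) by (intro pair_val_2) auto
    qed
    moreover have "u_val c y = 2"
      using 2 by (rule u_val_eqs)
    ultimately show ?thesis
      using assms(2) 2
      by (cases rule: cases_v; cases "even y") (simp_all add: pos_def mod2_eq_if)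
  next
    case 3
    then show ?thesis
      using assms by (simp add: u_val_def pos_def)
  next
    case 4
    have "pair_val c y 0"
      using 4 assms(1) by (intro pair_val_0) auto
    moreover have "pair_val c y 2"
      using 4 assms(1) by (intro pair_val_2) auto
    \<comment> \<open>An odd \<open>y\<close> has target 4 in this block and does not ask for the
      pair value 5; this spares \<open>4 * c + 1\<close>.\<close>
    moreover have "pair_val c y 5" if "even y"
    proof -
      have "y \<noteq> 4 * c + 1"
        using that by auto
      then show ?thesis
        using 4 assms(1) by (intro pair_val_5) auto
    qed
    moreover have "u_val c y = 5"
      using 4 by (rule u_val_eqs)
    ultimately show ?thesis
      using assms(2) 4
      by (cases rule: cases_v; cases "even y") (simp_all add: pos_def mod2_eq_if)
  next
    case 5
    then have "u_val c y = 3" by (simp add: u_val_def)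
    then show ?thesis
      using assms(2) 5
      by (cases rule: cases_v; cases "even y") (simp_all add: pos_def mod2_eq_if)
  next
    case 6
    then have "u_val c y = 4" by (simp add: u_val_def)
    then show ?thesis
      using assms(2) 6
      by (cases rule: cases_v; cases "even y") (simp_all add: pos_def mod2_eq_if)
  next
    \<comment> \<open>For odd \<open>y\<close> the target is 7, and \<open>v = 6\<close> asks for 7
      after cancelling the parity: here the entry of \<open>pos\<close> for 7 is used.\<close>
    case 7
    then have "u_val c y = 6" using assms(1) by (simp add: u_val_def)
    then show ?thesis
      using assms 7
      by (cases rule: cases_v; cases "even y") (simp_all add: pos_def mod2_eq_if)
  qed
qed

lemma below_in_opt_vals:
  assumes "c \<ge> 2" "g < w_seq c x XOR (x mod 2)"
  shows "g XOR (x mod 2) \<in> opt_vals c x"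
proof -
  define q y where "q = x div (12 * c)" and "y = x mod (12 * c)"
  define j v where "j = g div 8" and "v = g mod 8"
  have y: "y < 12 * c" and x: "x = 12 * c * q + y"
    using assms(1) by (simp_all add: q_def y_def)
  have v: "v < 8" and g: "g = 8 * j + v"
    by (simp_all add: j_def v_def)
  have x2: "x mod 2 = y mod 2"
    using x by (simp add: mod2_eq_if)
  have y2: "y mod 2 < 8"
    by (simp add: mod2_eq_if)
  have less: "k XOR (y mod 2) < 8" if "k < 8" for k
    using that by (elim less_8_cases) (simp_all add: mod2_eq_if)
  have gx: "g XOR (x mod 2) = 8 * j + (v XOR (y mod 2))"
    using xor_8[OF v y2, of j 0] by (simp add: g x2)
  have "w_seq c x XOR (x mod 2) = 8 * q + (u_val c y XOR (y mod 2))"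
    using xor_8[OF u_val_less[of c y] y2, of q 0] w_seq_add[OF y, of q] x x2 by simp
  then have lt: "8 * j + v < 8 * q + (u_val c y XOR (y mod 2))"
    using assms(2) g by simp
  show ?thesis
  proof (cases "j < q")
    case True
    \<comment> \<open>Adding the \<open>2 * c\<close> lost in a long split gives at most one full
      period, and \<open>x\<close> lies at least that far beyond the start of period
      \<open>j\<close>.\<close>
    have "pos c (v XOR (y mod 2)) \<le> 10 * c"
      using less[OF v] assms(1) by (elim less_8_cases) (simp_all add: pos_def)
    moreover have "12 * c * Suc j \<le> 12 * c * q"
      using True by (intro mult_le_mono2) simp
    ultimately show ?thesis
      using opt_vals_long[OF assms(1) less[OF v], of j x] x unfolding gx by simp
  next
    case False
    then have "j = q" "v < u_val c y XOR (y mod 2)"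
      using lt less[OF u_val_less[of c y]] by linarith+
    from period_option_exists[OF _ this(2)] assms(1) consider
        "pos c (v XOR (y mod 2)) + 2 * c \<le> y"
      | a b where "Suc (a + b) = y" "u_val c a XOR u_val c b = v XOR (y mod 2) XOR 1"
      by (auto simp: pair_val_def)
    then show ?thesis
    proof cases
      case 1
      then show ?thesis
        using opt_vals_long[OF assms(1) less[OF v], of j x] x \<open>j = q\<close> unfolding gx by simp
    next
      case 2
      have "u_val c a XOR u_val c b XOR 1 = (u_val c a XOR u_val c b) XOR 1"
        by (simp only: xor.assoc)
      also have "\<dots> = v XOR (y mod 2)"
        unfolding 2(2) by (simp only: xor.assoc xor_self_eq xor.right_neutral)
      finally show ?thesis
        using 2(1)
        using opt_vals_pair[of a c b q] x y \<open>j = q\<close> unfolding gx by simp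
    qed
  qed
qed

section \<open>From options of the game to \<open>opt_vals\<close>, and the induction\<close>

lemma cut_opts_eq_Suc_image:
  "cut_opts C n = map Suc ` {xs. \<exists>d\<in>C. 1 \<le> d \<and> length xs = d + 1 \<and> sum_list xs + length xs = n}"
proof (intro set_eqI iffI)
  fix hs assume hs: "hs \<in> cut_opts C n"
  \<comment> \<open>All heaps are at least 1, so \<open>Suc\<close> undoes the truncated
    subtraction.\<close>
  define xs where "xs = map (\<lambda>h. h - 1) hs"
  have "hs = map Suc xs"
    using hs by (auto simp: xs_def cut_opts_def intro!: map_idI[symmetric])
  moreover have "sum_list (map Suc xs) = sum_list xs + length xs"
    by (induction xs) simp_all
  ultimately show "hs \<in> map Suc ` {xs. \<exists>d\<in>C. 1 \<le> d \<and> length xs = d + 1 \<and> sum_list xs + length xs = n}"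
    using hs by (auto simp: cut_opts_def)
next
  fix hs assume "hs \<in> map Suc ` {xs. \<exists>d\<in>C. 1 \<le> d \<and> length xs = d + 1 \<and> sum_list xs + length xs = n}"
  moreover have "sum_list (map Suc xs) = sum_list xs + length xs" for xs
    by (induction xs) simp_all
  ultimately show "hs \<in> cut_opts C n"
    by (auto simp: cut_opts_def)
qed

lemma s_seq_option_values:
  assumes "c \<ge> 2"
  shows "(\<lambda>hs. nim_sum (map (s_seq c) hs)) ` cut_opts {1, 2 * c} (Suc x)
    = (\<lambda>v. v XOR (x mod 2)) ` opt_vals c x" (is "?L = ?R")
proof -
  have "{xs. \<exists>d\<in>{1, 2 * c}. 1 \<le> d \<and> length xs = d + 1 \<and> sum_list xs + length xs = Suc x}
      = {xs. length xs = 2 * c + 1 \<and> sum_list xs + 2 * c = x} \<union> {[a, b] |a b. Suc (a + b) = x}"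
    using assms by (auto simp: length_Suc_conv)
  then have "?L = (\<lambda>xs. w_sum c xs XOR (sum_list xs mod 2)) `
      ({xs. length xs = 2 * c + 1 \<and> sum_list xs + 2 * c = x} \<union> {[a, b] |a b. Suc (a + b) = x})"
    using assms unfolding cut_opts_eq_Suc_image image_image by (simp only: nim_sum_s_seq)
  also have "\<dots> = {w_sum c xs XOR (sum_list xs mod 2) |xs. length xs = 2 * c + 1 \<and> sum_list xs + 2 * c = x}
      \<union> {w_seq c a XOR w_seq c b XOR ((a + b) mod 2) |a b. Suc (a + b) = x}"
  proof -
    have "(\<lambda>xs. w_sum c xs XOR (sum_list xs mod 2)) ` {[a, b] |a b. Suc (a + b) = x}
        = (\<lambda>(a, b). w_sum c [a, b] XOR (sum_list [a, b] mod 2)) ` {(a, b). Suc (a + b) = x}"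
      by force
    then show ?thesis
      unfolding image_Un by (simp only:) (auto simp: xor.assoc image_iff)
  qed
  also have "\<dots> = {w_sum c xs XOR (x mod 2) |xs. length xs = 2 * c + 1 \<and> sum_list xs + 2 * c = x}
      \<union> {w_seq c a XOR w_seq c b XOR 1 XOR (x mod 2) |a b. Suc (a + b) = x}"
  proof -
    \<comment> \<open>A split into two heaps lowers the sum by one and flips the parity; a long
      split lowers it by the even number \<open>2 * c\<close>.\<close>
    have "(a + b) mod 2 = 1 XOR (x mod 2)" if "Suc (a + b) = x" for a b
      using that by (auto simp: mod2_eq_if)
    moreover have "sum_list xs mod 2 = x mod 2" if "sum_list xs + 2 * c = x" for xs
      using that by auto
    ultimately show ?thesis
      by (intro arg_cong2[of _ _ _ _ "(\<union>)"] Collect_cong) metis+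
  qed
  also have "\<dots> = ?R"
  proof -
    have "(\<lambda>v. v XOR (x mod 2)) ` {w_seq c a XOR w_seq c b XOR 1 |a b. Suc (a + b) = x}
        = {w_seq c a XOR w_seq c b XOR 1 XOR (x mod 2) |a b. Suc (a + b) = x}"
      by (simp only: image_Collect xor.assoc) (metis (no_types, lifting) xor.assoc)
    moreover have "(\<lambda>v. v XOR (x mod 2)) ` {w_sum c xs |xs. length xs = 2 * c + 1 \<and> sum_list xs + 2 * c = x}
        = {w_sum c xs XOR (x mod 2) |xs. length xs = 2 * c + 1 \<and> sum_list xs + 2 * c = x}"
      by blast
    ultimately show ?thesis
      unfolding opt_vals_def image_Un by (simp only:)
  qed
  finally show ?thesis .
qed

lemma nim_seq_eq_s_seq:
  assumes "c \<ge> 2"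
  shows "n \<ge> 1 \<Longrightarrow> nim_seq {1, 2 * c} n = s_seq c n"
proof (induction n rule: less_induct)
  case (less n)
  then obtain x where n: "n = Suc x"
    by (cases n) auto
  have "nim_sum (map (nim_seq {1, 2 * c}) hs) = nim_sum (map (s_seq c) hs)"
    if "hs \<in> cut_opts {1, 2 * c} n" for hs
  proof -
    have "nim_seq {1, 2 * c} h = s_seq c h" if "h \<in> set hs" for h
      using less.IH[of h] cut_opts_less[OF \<open>hs \<in> _\<close> that] that \<open>hs \<in> _\<close>
      by (auto simp: cut_opts_def)
    then show ?thesis
      by (metis map_cong)
  qed
  then have "(\<lambda>hs. nim_sum (map (nim_seq {1, 2 * c}) hs)) ` cut_opts {1, 2 * c} n
      = (\<lambda>hs. nim_sum (map (s_seq c) hs)) ` cut_opts {1, 2 * c} n"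
    by (rule image_cong[OF refl])
  also have "\<dots> = (\<lambda>v. v XOR (x mod 2)) ` opt_vals c x"
    unfolding n by (rule s_seq_option_values[OF assms])
  finally have "nim_seq {1, 2 * c} n = mex ((\<lambda>v. v XOR (x mod 2)) ` opt_vals c x)"
    by (subst nim_seq.simps) (rule arg_cong)
  also have "\<dots> = w_seq c x XOR (x mod 2)"
  proof (rule mex_eqI)
    \<comment> \<open>XOR with the fixed parity bit is an involution, so both mex conditions reduce
      to membership in \<open>opt_vals\<close>.\<close>
    have cancel: "(a XOR b) XOR b = a" for a b :: nat
      by (simp add: xor.assoc)
    show "w_seq c x XOR (x mod 2) \<notin> (\<lambda>v. v XOR (x mod 2)) ` opt_vals c x"
    proof
      assume "w_seq c x XOR (x mod 2) \<in> (\<lambda>v. v XOR (x mod 2)) ` opt_vals c x"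
      then obtain v where v: "v \<in> opt_vals c x" "w_seq c x XOR (x mod 2) = v XOR (x mod 2)"
        by (rule imageE)
      have "w_seq c x = v"
        using arg_cong[OF v(2), of "\<lambda>k. k XOR (x mod 2)"] unfolding cancel .
      then show False
        using w_seq_notin_opt_vals[of c x] assms v(1) by simp
    qed
    show "g \<in> (\<lambda>v. v XOR (x mod 2)) ` opt_vals c x" if "g < w_seq c x XOR (x mod 2)" for g
      by (rule image_eqI[where x = "g XOR (x mod 2)"]) (simp_all only: cancel below_in_opt_vals[OF assms that])
  qed
  also have "\<dots> = s_seq c n"
    using assms n by (simp add: s_seq_Suc)
  finally show ?case .
qed

section \<open>The closed form as a repeated block\<close>

lemma length_rep: "length (rep xs j) = j * length xs"
  by (induction j) (simp_all add: rep_def)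

lemma nth_rep_2: "i < 2 * j \<Longrightarrow> rep [a, b] j ! i = (if even i then a else b)"
proof (induction j arbitrary: i)
  case (Suc j)
  have "rep [a, b] (Suc j) = a # b # rep [a, b] j"
    by (simp add: rep_def)
  then show ?case
    using Suc.IH[of "i - 2"] Suc.prems by (cases i; cases "i - 1") auto
qed simp

lemma length_cut_block: "c \<ge> 1 \<Longrightarrow> length (cut_block c) = 12 * c"
  by (simp add: cut_block_def length_rep)

lemma nth_cut_block:
  assumes "c \<ge> 1" "i < 12 * c"
  shows "cut_block c ! i = t_val c (Suc i)"
proof -
  \<comment> \<open>\<open>M\<close> is the first half of the block. Writing \<open>[1, 4]\<close>
    as a \<open>rep\<close> lets \<open>nth_rep_2\<close> treat all pieces alike, and beyond
    \<open>6 * c\<close> only the length of \<open>M\<close> matters.\<close>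
  define M where "M = rep [0, 1] c @ rep [2, 3] c @ rep [1, 4] 1 @ rep [5, 4 :: nat] (c - 1)"
  have len: "length M = 6 * c"
    using assms(1) by (simp add: M_def length_rep)
  have cut: "cut_block c = M @ rep [3, 2] c @ rep [4, 5] c @ rep [6, 7] c"
    by (simp add: cut_block_def M_def rep_def)
  note simps = nth_append length_rep nth_rep_2 t_val_def
  consider "i < 2 * c" | "i = 4 * c" | "i = 4 * c + 1" | "2 * c \<le> i" "i < 4 * c"
    | "4 * c + 2 \<le> i" "i < 6 * c" | "6 * c \<le> i" "i < 8 * c"
    | "8 * c \<le> i" "i < 10 * c" | "10 * c \<le> i"
    using assms(2) by linarith
  then show ?thesis
  proof cases
    case 1
    then show ?thesis
      using assms(1) by (simp add: cut M_def simps)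
  next
    case 2
    then show ?thesis
      using assms(1) by (simp add: cut M_def simps)
  next
    case 3
    then show ?thesis
      using assms(1) by (simp add: cut M_def simps)
  next
    case 4
    then obtain k where "i = 2 * c + k"
      using le_Suc_ex by blast
    then show ?thesis
      using 4 assms by (simp add: cut M_def simps)
  next
    case 5
    then obtain k where "i = 4 * c + 2 + k"
      using le_Suc_ex by blast
    then show ?thesis
      using 5 assms by (simp add: cut M_def simps)
  next
    case 6
    then obtain k where "i = 6 * c + k"
      using le_Suc_ex by blast
    then show ?thesis
      using 6 assms by (simp add: cut len simps)
  next
    case 7
    then obtain k where "i = 8 * c + k"
      using le_Suc_ex by blast
    then show ?thesis
      using 7 assms by (simp add: cut len simps)
  next
    case 8
    then obtain k where "i = 10 * c + k"
      using le_Suc_ex by blast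
    then show ?thesis
      using 8 assms by (simp add: cut len simps)
  qed
qed

lemma plus_seq_cut_block:
  assumes "c \<ge> 1"
  shows "plus_seq (cut_block c) 8 n = s_seq c n"
  using assms by (simp add: plus_seq_def s_seq_def length_cut_block nth_cut_block)

lemma arith_periodic_s_seq:
  assumes "c \<ge> 1" "n \<ge> 1"
  shows "s_seq c (n + 12 * c) = s_seq c n + 8"
proof -
  have eq: "n + 12 * c - 1 = (n - 1) + 12 * c"
    using assms(2) by simp
  show ?thesis
    unfolding s_seq_def eq using div_add_self2[of "12 * c" "n - 1"] assms(1) by (simp only: mod_add_self2) simp
qed

theorem theorem1:
  fixes c :: nat
  assumes "c \<ge> 2"
  shows "(\<forall>n\<ge>1. nim_seq {1, 2 * c} n = s_seq c n)
    \<and> (\<forall>n\<ge>1. nim_seq {1, 2 * c} n = plus_seq (cut_block c) 8 n)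
    \<and> length (cut_block c) = 12 * c
    \<and> arith_periodic (nim_seq {1, 2 * c}) (12 * c) 8"
proof -
  have eq: "nim_seq {1, 2 * c} n = s_seq c n" if "n \<ge> 1" for n
    using nim_seq_eq_s_seq[OF assms that] .
  have "arith_periodic (nim_seq {1, 2 * c}) (12 * c) 8"
    using assms eq arith_periodic_s_seq[of c] unfolding arith_periodic_def by auto
  then show ?thesis
    using assms eq plus_seq_cut_block[of c] length_cut_block[of c] by simp
qed

end
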